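(* Let $K$ be a field, let $\mathscr{P}=\mathbb{Z}^d$ or $\mathbb{R}^d$ (with the product order), and let $\mathcal{S}=(S_1,\ldots,S_n)$ be a sequence of pairwise disjoint finite subsets of $\mathscr{P}$, where $n\geq 2$. Let $M$ and $N$ be two pointwise finite-dimensional $\mathscr{P}$-persistence modules over $K$. Then $$d_L(M,N)_{\mathcal{S}}\leq d_E(M,N)_{\mathcal{S}}\leq d_I(M,N),$$ where $d_L(\cdot,\cdot)_{\mathcal S}$ and $d_E(\cdot,\cdot)_{\mathcal S}$ are the landscape and erosion distances at $\mathcal{S}$, and $d_I$ is the interleaving distance.
   Context: Persistence modules. A $\mathscr{P}$-persistence module $M$ is a functor from the poset $\mathscr{P}$ to $K$-vector spaces, with spaces $M_x$ and structure maps $M_{yx}=M_{y,x}:M_x\to M_y$ for $x\leq y$; it is pointwise finite-dimensional if all $M_x$ are finite-dimensional. For $\varepsilon\in\mathscr{P}$ the shift $M[\varepsilon]$ is given by $(M[\varepsilon])_x=M_{x+\varepsilon}$, $(M[\varepsilon])_{yx}=M_{y+\varepsilon,x+\varepsilon}$ (and similarly $f[\varepsilon]_x=f_{x+\varepsilon}$ for a homomorphism $f$). For $\varepsilon\geq 0$ in $\mathscr{P}$, $\mathsf{sh}^\varepsilon_M:M\to M[\varepsilon]$ is the homomorphism with components $M_{x+\varepsilon,x}$. Jordan modules. Write $M|_{\mathcal S}:=\bigoplus_{x\in\bigcup_iS_i}M_x$. The nilpotent operator $\mathbf{T}_{M,\mathcal{S}}$ on $M|_{\mathcal S}$ is the one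 which, for each $i\in\{1,\ldots,n-1\}$, maps $\bigoplus_{x\in S_i}M_x$ to $\bigoplus_{y\in S_{i+1}}M_y$ with $(y,x)$-entry equal to $M_{yx}$ if $x<y$ and $0$ otherwise, and which is zero on $\bigoplus_{x\in S_n}M_x$. For $i\in\mathbb{N}$, the $\mathscr{P}$-module $M^i_{\mathcal S}$ is defined by $(M^i_{\mathcal S})_x:=\operatorname{Im}(\mathbf{T}^i_{M[x],\mathcal{S}})\subseteq M[x]|_{\mathcal S}=\bigoplus_{z\in \bigcup_jS_j}M_{x+z}$, with structure map $(M^i_{\mathcal S})_{y,x}$, for $x\leq y$, the restriction of $\bigoplus_{z}M_{y+z,x+z}$ to $\operatorname{Im}(\mathbf{T}^i_{M[x],\mathcal{S}})$ (which lands in $\operatorname{Im}(\mathbf{T}^i_{M[y],\mathcal{S}})$). Rank invariants. The rank invariant of a $\mathscr{P}$-module $X$ is $\mathbf{rk}_X:\mathscr{P}\times\mathscr{P}\to\mathbb{N}\cup\{\infty\}$, $\mathbf{rk}_X(x,y)=\operatorname{rank}(X_{yx})$ if $x\leq y$ and $\infty$ otherwise. Put $\mathbf{rk}^i_{M,\mathcal S}:=\mathbf{rk}_{M^i_{\mathcal S}}$. Distances. Let $\mathbb{T}=\mathbb{Z}$ if $\mathscr{P}=\mathbb{Z}^d$ and $\mathbb{T}=\mathbb{R}$ if $\mathscr{P}=\mathbb{R}^d$; for $\varepsilon\in\mathbb{T}$ let $\overrightarrow{\varepsilon}=(\varepsilon,\ldots,\varepsilon)\in\mathscr{P}$. Infima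 of empty sets are $\infty$, suprema of empty sets are $0$, and $|\infty-\infty|=0$. Interleaving distance: $d_I(M,N)$ is the infimum of all $\varepsilon\in\mathbb{T}_{\geq0}$ for which there exist homomorphisms $\varphi:M\to N[\overrightarrow{\varepsilon}]$ and $\psi:N\to M[\overrightarrow{\varepsilon}]$ with $\psi[\overrightarrow{\varepsilon}]\circ\varphi=\mathsf{sh}_M^{2\overrightarrow{\varepsilon}}$ and $\varphi[\overrightarrow{\varepsilon}]\circ\psi=\mathsf{sh}_N^{2\overrightarrow{\varepsilon}}$. Erosion distance: for $F,G:\mathscr{P}\times\mathscr{P}\to\mathbb{N}\cup\{\infty\}$ (rank invariants), $d_E(F,G)$ is the infimum of all $\varepsilon\in\mathbb{T}_{\ge0}$ such that $F(x-\overrightarrow{\varepsilon},y+\overrightarrow{\varepsilon})\leq G(x,y)$ and $G(x-\overrightarrow{\varepsilon},y+\overrightarrow{\varepsilon})\leq F(x,y)$ for all $x,y\in\mathscr{P}$. Then $d_E(M,N)_{\mathcal S}:=\max_{0\leq i\leq n-1}d_E(\mathbf{rk}^i_{M,\mathcal S},\mathbf{rk}^i_{N,\mathcal S})$. Landscapes: for a $\mathscr{P}$-module $X$, $\lambda_X:\mathbb{N}\times\mathscr{P}\to[0,\infty]$ is $\lambda_X(k,x):=\sup\{\varepsilon\in\mathbb{T},\ \varepsilon>0\mid \mathbf{rk}_X(x-\mathbf{h},x+\mathbf{h})\geq k\text{ for all }\mathbf{h}\in\mathscr{P}\text{ with }\|\mathbf{h}\|_\infty\leq\varepsilon\}$.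 Then $d_L(M,N)_{\mathcal S}:=\max_{0\leq i\leq n-1}\|\lambda_{M^i_{\mathcal S}}-\lambda_{N^i_{\mathcal S}}\|_\infty$, where $\|\cdot\|_\infty$ is the supremum over $\mathbb{N}\times\mathscr{P}$. *)

theory Defs
  imports "HOL-Analysis.Analysis" "HOL-Library.Function_Algebras"
begin

subsection \<open>The index posets\<close>

text \<open>
  Both index posets are subsets of \<open>real^'d\<close>, whose order is the product order:
  \<open>grid \<int>\<close> is \<open>\<int>\<^sup>d\<close> and \<open>grid UNIV\<close> is \<open>\<real>\<^sup>d\<close>, with \<open>d = CARD('d)\<close>. The set \<open>T\<close> is also the
  range of the distance parameter \<open>\<epsilon>\<close>, and \<open>vec \<epsilon>\<close> is the diagonal vector \<open>(\<epsilon>,...,\<epsilon>)\<close>.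
\<close>

definition grid :: "real set \<Rightarrow> (real^'d) set"
  where "grid T = {x. \<forall>i. x $ i \<in> T}"

subsection \<open>Persistence modules\<close>

text \<open>
  The spaces of a module are subspaces of an arbitrary ambient vector space with carrier type \<open>'v\<close>
  and scalar multiplication \<open>s :: 'k \<Rightarrow> 'v \<Rightarrow> 'v\<close>. This is no restriction: any family of vector
  spaces embeds into its direct sum. Values outside the indexing poset and the values of structure
  maps outside their domains are irrelevant.

  \<open>mp M y x\<close> is the structure map from \<open>sp M x\<close> to \<open>sp M y\<close>, so the target index comes first.
\<close>

record ('p, 'v) pmod =
  sp :: "'p \<Rightarrow> 'v set"
  mp :: "'p \<Rightarrow> 'p \<Rightarrow> 'v \<Rightarrow> 'v"

definition linear_betw ::
  "('k::field \<Rightarrow> 'v::ab_group_add \<Rightarrow> 'v) \<Rightarrow> ('k \<Rightarrow> 'w::ab_group_add \<Rightarrow> 'w) \<Rightarrow>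
   'v set \<Rightarrow> 'w set \<Rightarrow> ('v \<Rightarrow> 'w) \<Rightarrow> bool"
  where "linear_betw s t V W f \<longleftrightarrow>
    f \<in> V \<rightarrow> W \<and>
    (\<forall>u\<in>V. \<forall>v\<in>V. f (u + v) = f u + f v) \<and>
    (\<forall>c. \<forall>v\<in>V. f (s c v) = t c (f v))"

definition persistence_module ::
  "'p::order set \<Rightarrow> ('k::field \<Rightarrow> 'v::ab_group_add \<Rightarrow> 'v) \<Rightarrow> ('p, 'v) pmod \<Rightarrow> bool"
  where "persistence_module P s M \<longleftrightarrow>
    vector_space s \<and>
    (\<forall>x\<in>P. module.subspace s (sp M x)) \<and>
    (\<forall>x\<in>P. \<forall>y\<in>P. x \<le> y \<longrightarrow> linear_betw s s (sp M x) (sp M y) (mp M y x)) \<and>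
    (\<forall>x\<in>P. \<forall>v\<in>sp M x. mp M x x v = v) \<and>
    (\<forall>x\<in>P. \<forall>y\<in>P. \<forall>z\<in>P. x \<le> y \<longrightarrow> y \<le> z \<longrightarrow>
       (\<forall>v\<in>sp M x. mp M z y (mp M y x v) = mp M z x v))"

definition finite_dim :: "('k::field \<Rightarrow> 'v::ab_group_add \<Rightarrow> 'v) \<Rightarrow> 'v set \<Rightarrow> bool"
  where "finite_dim s V \<longleftrightarrow> (\<exists>B. finite B \<and> V \<subseteq> module.span s B)"

definition pointwise_finite_dim ::
  "'p set \<Rightarrow> ('k::field \<Rightarrow> 'v::ab_group_add \<Rightarrow> 'v) \<Rightarrow> ('p, 'v) pmod \<Rightarrow> bool"
  where "pointwise_finite_dim P s M \<longleftrightarrow> (\<forall>x\<in>P. finite_dim s (sp M x))"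

definition pm_hom ::
  "'p::order set \<Rightarrow> ('k::field \<Rightarrow> 'v::ab_group_add \<Rightarrow> 'v) \<Rightarrow> ('k \<Rightarrow> 'w::ab_group_add \<Rightarrow> 'w) \<Rightarrow>
   ('p, 'v) pmod \<Rightarrow> ('p, 'w) pmod \<Rightarrow> ('p \<Rightarrow> 'v \<Rightarrow> 'w) \<Rightarrow> bool"
  where "pm_hom P s t M N f \<longleftrightarrow>
    (\<forall>x\<in>P. linear_betw s t (sp M x) (sp N x) (f x)) \<and>
    (\<forall>x\<in>P. \<forall>y\<in>P. x \<le> y \<longrightarrow> (\<forall>v\<in>sp M x. f y (mp M y x v) = mp N y x (f x v)))"

definition shift :: "('p::plus, 'v) pmod \<Rightarrow> 'p \<Rightarrow> ('p, 'v) pmod"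
  where "shift M e = \<lparr>sp = (\<lambda>x. sp M (x + e)), mp = (\<lambda>y x. mp M (y + e) (x + e))\<rparr>"

definition shift_hom :: "('p::plus \<Rightarrow> 'v \<Rightarrow> 'w) \<Rightarrow> 'p \<Rightarrow> 'p \<Rightarrow> 'v \<Rightarrow> 'w"
  where "shift_hom f e = (\<lambda>x. f (x + e))"

definition sh :: "('p::plus, 'v) pmod \<Rightarrow> 'p \<Rightarrow> 'p \<Rightarrow> 'v \<Rightarrow> 'v"
  where "sh M e = (\<lambda>x. mp M (x + e) x)"

subsection \<open>Jordan modules\<close>

text \<open>
  The direct sum of the \<open>sp M x\<close> over \<open>x\<close> in the union of the finite sets \<open>S\<^sub>i\<close> is realised by
  functions \<open>'p \<Rightarrow> 'v\<close> vanishing outside that union, with pointwise operations. The sequence \<open>S\<close> is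
  a list and hence indexed from \<open>0\<close>: \<open>S ! i\<close> is \<open>S\<^bsub>i+1\<^esub>\<close>.
\<close>

definition scale_pw :: "('k \<Rightarrow> 'v \<Rightarrow> 'v) \<Rightarrow> 'k \<Rightarrow> ('p \<Rightarrow> 'v) \<Rightarrow> 'p \<Rightarrow> 'v"
  where "scale_pw s c f = (\<lambda>z. s c (f z))"

definition restr :: "('p, 'v::zero) pmod \<Rightarrow> 'p set list \<Rightarrow> ('p \<Rightarrow> 'v) set"
  where "restr M S = {f. (\<forall>z\<in>\<Union>(set S). f z \<in> sp M z) \<and> (\<forall>z. z \<notin> \<Union>(set S) \<longrightarrow> f z = 0)}"

definition jordan_op :: "('p::order, 'v::ab_group_add) pmod \<Rightarrow> 'p set list \<Rightarrow> ('p \<Rightarrow> 'v) \<Rightarrow> 'p \<Rightarrow> 'v"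
  where "jordan_op M S f = (\<lambda>y. \<Sum>i<length S - 1.
    if y \<in> S ! Suc i then (\<Sum>x\<in>S ! i. if x < y then mp M y x (f x) else 0) else 0)"

definition jordan_module ::
  "('p::{order,plus}, 'v::ab_group_add) pmod \<Rightarrow> 'p set list \<Rightarrow> nat \<Rightarrow> ('p, 'p \<Rightarrow> 'v) pmod"
  where "jordan_module M S i =
    \<lparr>sp = (\<lambda>x. (jordan_op (shift M x) S ^^ i) ` restr (shift M x) S),
     mp = (\<lambda>y x f z. if z \<in> \<Union>(set S) then mp M (y + z) (x + z) (f z) else 0)\<rparr>"

subsection \<open>Rank invariants\<close>

definition rank_inv ::
  "('k::field \<Rightarrow> 'v::ab_group_add \<Rightarrow> 'v) \<Rightarrow> ('p::order, 'v) pmod \<Rightarrow> 'p \<Rightarrow> 'p \<Rightarrow> enat"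
  where "rank_inv s X x y =
    (if x \<le> y \<and> finite_dim s (mp X y x ` sp X x)
     then enat (vector_space.dim s (mp X y x ` sp X x)) else \<infinity>)"

definition jordan_rank ::
  "('k::field \<Rightarrow> 'v::ab_group_add \<Rightarrow> 'v) \<Rightarrow> ('p::{order,plus}, 'v) pmod \<Rightarrow> 'p set list \<Rightarrow>
   nat \<Rightarrow> 'p \<Rightarrow> 'p \<Rightarrow> enat"
  where "jordan_rank s M S i = rank_inv (scale_pw s) (jordan_module M S i)"

subsection \<open>Distances\<close>

text \<open>
  Distances take values in \<open>ennreal\<close>, where \<open>Inf {} = \<infinity>\<close> and \<open>Sup {} = 0\<close>.
\<close>

definition interleaved ::
  "real set \<Rightarrow> ('k::field \<Rightarrow> 'v::ab_group_add \<Rightarrow> 'v) \<Rightarrow> ('k \<Rightarrow> 'w::ab_group_add \<Rightarrow> 'w) \<Rightarrow>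
   (real^'d, 'v) pmod \<Rightarrow> (real^'d, 'w) pmod \<Rightarrow> real \<Rightarrow> bool"
  where "interleaved T s t M N \<epsilon> \<longleftrightarrow>
    (\<exists>\<phi> \<psi>. pm_hom (grid T) s t M (shift N (vec \<epsilon>)) \<phi> \<and>
           pm_hom (grid T) t s N (shift M (vec \<epsilon>)) \<psi> \<and>
           (\<forall>x\<in>grid T. \<forall>v\<in>sp M x. shift_hom \<psi> (vec \<epsilon>) x (\<phi> x v) = sh M (vec (2 * \<epsilon>)) x v) \<and>
           (\<forall>x\<in>grid T. \<forall>w\<in>sp N x. shift_hom \<phi> (vec \<epsilon>) x (\<psi> x w) = sh N (vec (2 * \<epsilon>)) x w))"

definition interleaving_dist ::
  "real set \<Rightarrow> ('k::field \<Rightarrow> 'v::ab_group_add \<Rightarrow> 'v) \<Rightarrow> ('k \<Rightarrow> 'w::ab_group_add \<Rightarrow> 'w) \<Rightarrow>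
   (real^'d, 'v) pmod \<Rightarrow> (real^'d, 'w) pmod \<Rightarrow> ennreal"
  where "interleaving_dist T s t M N =
    Inf (ennreal ` {\<epsilon>\<in>T. 0 \<le> \<epsilon> \<and> interleaved T s t M N \<epsilon>})"

definition erosion_dist ::
  "real set \<Rightarrow> (real^'d \<Rightarrow> real^'d \<Rightarrow> enat) \<Rightarrow> (real^'d \<Rightarrow> real^'d \<Rightarrow> enat) \<Rightarrow> ennreal"
  where "erosion_dist T F G =
    Inf (ennreal ` {\<epsilon>\<in>T. 0 \<le> \<epsilon> \<and>
      (\<forall>x\<in>grid T. \<forall>y\<in>grid T.
         F (x - vec \<epsilon>) (y + vec \<epsilon>) \<le> G x y \<and> G (x - vec \<epsilon>) (y + vec \<epsilon>) \<le> F x y)})"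

definition erosion_dist_at ::
  "real set \<Rightarrow> ('k::field \<Rightarrow> 'v::ab_group_add \<Rightarrow> 'v) \<Rightarrow> ('k \<Rightarrow> 'w::ab_group_add \<Rightarrow> 'w) \<Rightarrow>
   (real^'d) set list \<Rightarrow> (real^'d, 'v) pmod \<Rightarrow> (real^'d, 'w) pmod \<Rightarrow> ennreal"
  where "erosion_dist_at T s t S M N =
    (MAX i\<in>{0..length S - 1}. erosion_dist T (jordan_rank s M S i) (jordan_rank t N S i))"

definition landscape ::
  "real set \<Rightarrow> ('k::field \<Rightarrow> 'v::ab_group_add \<Rightarrow> 'v) \<Rightarrow> (real^'d, 'v) pmod \<Rightarrow>
   nat \<Rightarrow> real^'d \<Rightarrow> ennreal"
  where "landscape T s X k x =
    Sup (ennreal ` {\<epsilon>\<in>T. 0 < \<epsilon> \<and>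
      (\<forall>h\<in>grid T. infnorm h \<le> \<epsilon> \<longrightarrow> enat k \<le> rank_inv s X (x - h) (x + h))})"

text \<open>
  Subtraction on \<open>ennreal\<close> is truncated, and \<open>\<infinity> - \<infinity> = \<infinity>\<close> there; the convention for
  landscapes is \<open>0\<close> instead.
\<close>

definition abs_diff :: "ennreal \<Rightarrow> ennreal \<Rightarrow> ennreal"
  where "abs_diff a b = (if a = \<infinity> \<and> b = \<infinity> then 0 else max (a - b) (b - a))"

definition sup_dist ::
  "real set \<Rightarrow> (nat \<Rightarrow> real^'d \<Rightarrow> ennreal) \<Rightarrow> (nat \<Rightarrow> real^'d \<Rightarrow> ennreal) \<Rightarrow> ennreal"
  where "sup_dist T l m = (SUP (k, x)\<in>UNIV \<times> grid T. abs_diff (l k x) (m k x))"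

definition landscape_dist_at ::
  "real set \<Rightarrow> ('k::field \<Rightarrow> 'v::ab_group_add \<Rightarrow> 'v) \<Rightarrow> ('k \<Rightarrow> 'w::ab_group_add \<Rightarrow> 'w) \<Rightarrow>
   (real^'d) set list \<Rightarrow> (real^'d, 'v) pmod \<Rightarrow> (real^'d, 'w) pmod \<Rightarrow> ennreal"
  where "landscape_dist_at T s t S M N =
    (MAX i\<in>{0..length S - 1}.
       sup_dist T (landscape T (scale_pw s) (jordan_module M S i))
                  (landscape T (scale_pw t) (jordan_module N S i)))"

end

theory Submission
  imports Defs
begin

text \<open>
  A homomorphism \<open>M \<rightarrow> N[\<epsilon>]\<close> acts componentwise on the direct sums over \<open>S\<close> and commutes with
  the nilpotent operators, so it restricts to their images: interleavings of \<open>M\<close> and \<open>N\<close>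
  induce interleavings of all Jordan modules. Hence \<open>M\<^sup>i\<^bsub>x-\<epsilon>\<^esub> \<rightarrow> M\<^sup>i\<^bsub>y+\<epsilon>\<^esub>\<close> factors through
  \<open>N\<^sup>i\<^bsub>x\<^esub> \<rightarrow> N\<^sup>i\<^bsub>y\<^esub>\<close>, which bounds its rank. For the landscapes, a radius \<open>\<delta>\<close> admissible for one
  rank function leaves the radius \<open>\<delta> - \<epsilon>\<close> admissible for an \<open>\<epsilon>\<close>-eroded one.
\<close>

subsection \<open>Linear maps between subspaces\<close>

lemma linear_betw_zero:
  assumes "vector_space s" "module.subspace s V" "linear_betw s t V W f"
  shows "f 0 = 0"
proof -
  interpret vector_space s by fact
  have "0 \<in> V" using assms(2) by (rule subspace_0)
  then have "f (0 + 0) = f 0 + f 0" using assms(3) unfolding linear_betw_def by blast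
  then show ?thesis by simp
qed

text \<open>Additivity is known only on \<open>V\<close>, so the induction also keeps the partial
  sums in \<open>V\<close>. Over an infinite index set both sums are 0 and the claim reduces to
  \<open>f 0 = 0\<close>.\<close>

lemma linear_betw_sum:
  assumes "vector_space s" "module.subspace s V" "linear_betw s t V W f"
    and "\<And>i. i \<in> I \<Longrightarrow> g i \<in> V"
  shows "f (\<Sum>i\<in>I. g i) = (\<Sum>i\<in>I. f (g i))"
proof -
  interpret vector_space s by fact
  show ?thesis using assms(4)
  proof (induction I rule: infinite_finite_induct)
    case (insert a I)
    have "(\<Sum>i\<in>I. g i) \<in> V" using insert.prems assms(2) by (intro subspace_sum) auto
    then have "f (g a + (\<Sum>i\<in>I. g i)) = f (g a) + f (\<Sum>i\<in>I. g i)"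
      using assms(3) insert.prems unfolding linear_betw_def by blast
    then show ?case using insert by simp
  qed (use linear_betw_zero[OF assms(1-3)] in simp_all)
qed

text \<open>The vectors of \<open>V\<close> that \<open>f\<close> sends into the target span form a
  subspace containing \<open>B\<close>, hence contain the span of \<open>B\<close>.\<close>

lemma linear_betw_image_span:
  assumes "vector_space s" "vector_space t" "module.subspace s V" "linear_betw s t V W f" "B \<subseteq> V"
  shows "f ` module.span s B \<subseteq> module.span t (f ` B)"
proof -
  interpret V: vector_space s by fact
  interpret W: vector_space t by fact
  let ?U = "{v \<in> V. f v \<in> W.span (f ` B)}"
  have "V.subspace ?U"
  proof (rule V.subspaceI)
    show "0 \<in> ?U"
      using linear_betw_zero[OF assms(1,3,4)] V.subspace_0[OF assms(3)] by (simp add: W.span_zero)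
  next
    fix x y assume "x \<in> ?U" "y \<in> ?U"
    then show "x + y \<in> ?U"
      using assms(4) V.subspace_add[OF assms(3)] by (auto simp: linear_betw_def W.span_add)
  next
    fix c x assume "x \<in> ?U"
    then show "s c x \<in> ?U"
      using assms(4) V.subspace_scale[OF assms(3)] by (auto simp: linear_betw_def W.span_scale)
  qed
  moreover have "B \<subseteq> ?U" using assms(5) by (auto intro: W.span_base)
  ultimately have "V.span B \<subseteq> ?U" by (intro V.span_minimal)
  then show ?thesis by auto
qed

text \<open>The image of a basis of \<open>U\<close> spans the image of \<open>U\<close> and has no
  more elements than the basis. Since \<open>U\<close> is an arbitrary subset of \<open>V\<close>,
  the bound applies to images of structure maps without first showing that they are
  subspaces.\<close>

lemma dim_linear_betw_image_le:
  assumes "vector_space s" "vector_space t" "module.subspace s V" "linear_betw s t V W f"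
    and "U \<subseteq> V" "finite_dim s U"
  shows "finite_dim t (f ` U)" "vector_space.dim t (f ` U) \<le> vector_space.dim s U"
proof -
  interpret V: vector_space s by fact
  interpret W: vector_space t by fact
  obtain B where B: "B \<subseteq> U" "V.independent B" "U \<subseteq> V.span B" "card B = V.dim U"
    using V.basis_exists by blast
  obtain C where "finite C" "U \<subseteq> V.span C" using assms(6) by (auto simp: finite_dim_def)
  then have fin: "finite B" using V.independent_span_bound B by (meson order_trans)
  have sub: "f ` U \<subseteq> W.span (f ` B)"
    using linear_betw_image_span[OF assms(1-4), of B] B(1,3) assms(5) by blast
  then show "finite_dim t (f ` U)" using fin by (auto simp: finite_dim_def)
  have "W.dim (f ` U) \<le> card (f ` B)" using sub fin by (intro W.dim_le_card) auto
  also have "\<dots> \<le> V.dim U" using card_image_le[OF fin] B(4) by metis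
  finally show "W.dim (f ` U) \<le> V.dim U" .
qed

lemma finite_dim_mono: "finite_dim s V" if "V \<subseteq> W" "finite_dim s W"
  using that by (auto simp: finite_dim_def)

text \<open>Finite dimension matters here: \<open>dim\<close> is a natural number, and an infinite
  basis would give it the value 0.\<close>

lemma dim_mono_finite_dim:
  assumes "vector_space s" "V \<subseteq> W" "finite_dim s W"
  shows "vector_space.dim s V \<le> vector_space.dim s W"
proof -
  interpret vector_space s by fact
  obtain B where B: "B \<subseteq> W" "independent B" "W \<subseteq> span B" "card B = dim W"
    using basis_exists by blast
  obtain C where "finite C" "W \<subseteq> span C" using assms(3) by (auto simp: finite_dim_def)
  then have "finite B" using independent_span_bound B by (meson order_trans)
  then show ?thesis using dim_le_card[of V B] B assms(2) by auto
qed

subsection \<open>Homomorphisms of Jordan modules\<close>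

lemma persistence_module_subspace: "module.subspace s (sp M x)"
  if "persistence_module P s M" "x \<in> P"
  using that by (simp add: persistence_module_def)

lemma persistence_module_linear_betw: "linear_betw s s (sp M x) (sp M y) (mp M y x)"
  if "persistence_module P s M" "x \<in> P" "y \<in> P" "x \<le> y"
  using that by (simp add: persistence_module_def)

lemma pm_hom_linear_betw: "linear_betw s t (sp M x) (sp N x) (f x)"
  if "pm_hom P s t M N f" "x \<in> P"
  using that by (simp add: pm_hom_def)

text \<open>Direct sum of the maps \<open>g z\<close>, with value 0 off \<open>A\<close> to match
  direct sums encoded as functions vanishing there. It describes both the structure maps of Jordan
  modules and the maps induced by homomorphisms.\<close>

definition dsum_map :: "'p set \<Rightarrow> ('p \<Rightarrow> 'v \<Rightarrow> 'w::zero) \<Rightarrow> ('p \<Rightarrow> 'v) \<Rightarrow> 'p \<Rightarrow> 'w"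
  where "dsum_map A g f = (\<lambda>z. if z \<in> A then g z (f z) else 0)"

lemma mp_jordan_module:
  "mp (jordan_module M S i) y x = dsum_map (\<Union>(set S)) (\<lambda>z. mp M (y + z) (x + z))"
  by (simp add: jordan_module_def dsum_map_def fun_eq_iff)

lemma sp_jordan_module:
  "sp (jordan_module M S i) x = (jordan_op (shift M x) S ^^ i) ` restr (shift M x) S"
  by (simp add: jordan_module_def)

lemma vector_space_scale_pw: "vector_space (scale_pw s)" if "vector_space s"
proof -
  interpret vector_space s by fact
  show ?thesis
    by unfold_locales
      (simp_all add: scale_pw_def fun_eq_iff scale_right_distrib scale_left_distrib)
qed

lemma restr_mem: "f z \<in> sp M z" if "f \<in> restr M S" "z \<in> \<Union>(set S)"
  using that unfolding restr_def by blast

lemma restr_outside: "f z = 0" if "f \<in> restr M S" "z \<notin> \<Union>(set S)"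
  using that unfolding restr_def by blast

lemma restrI:
  assumes "\<And>z. z \<in> \<Union>(set S) \<Longrightarrow> f z \<in> sp M z" "\<And>z. z \<notin> \<Union>(set S) \<Longrightarrow> f z = 0"
  shows "f \<in> restr M S"
  using assms unfolding restr_def by blast

lemma subspace_restr:
  assumes "persistence_module P s M" "\<Union>(set S) \<subseteq> P"
  shows "module.subspace (scale_pw s) (restr M S)"
proof -
  have vs: "vector_space s" using assms(1) by (simp add: persistence_module_def)
  interpret V: vector_space s by fact
  interpret F: vector_space "scale_pw s" by (rule vector_space_scale_pw[OF vs])
  have sub: "V.subspace (sp M z)" if "z \<in> \<Union>(set S)" for z
    using that assms(2) by (intro persistence_module_subspace[OF assms(1)]) blast
  show ?thesis
  proof (rule F.subspaceI)
    show "0 \<in> restr M S" using V.subspace_0[OF sub] by (intro restrI) simp_all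
  next
    fix f g assume f: "f \<in> restr M S" and g: "g \<in> restr M S"
    show "f + g \<in> restr M S"
    proof (rule restrI)
      fix z assume z: "z \<in> \<Union>(set S)"
      then show "(f + g) z \<in> sp M z"
        using V.subspace_add[OF sub[OF z] restr_mem[OF f z] restr_mem[OF g z]] by simp
    qed (simp add: restr_outside[OF f] restr_outside[OF g] del: Union_iff)
  next
    fix c f assume f: "f \<in> restr M S"
    show "scale_pw s c f \<in> restr M S"
    proof (rule restrI)
      fix z assume z: "z \<in> \<Union>(set S)"
      then show "scale_pw s c f z \<in> sp M z"
        using V.subspace_scale[OF sub[OF z] restr_mem[OF f z]] by (simp add: scale_pw_def)
    qed (simp add: scale_pw_def restr_outside[OF f] del: Union_iff)
  qed
qed

lemma linear_betw_dsum_map: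
  assumes "vector_space t" "\<And>z. z \<in> \<Union>(set S) \<Longrightarrow> linear_betw s t (sp M z) (sp N z) (g z)"
  shows "linear_betw (scale_pw s) (scale_pw t) (restr M S) (restr N S) (dsum_map (\<Union>(set S)) g)"
proof -
  interpret vector_space t by fact
  define A where "A = \<Union>(set S)"
  have mem: "g z v \<in> sp N z" if "z \<in> A" "v \<in> sp M z" for z v
    using assms(2)[OF that(1)[unfolded A_def]] that(2) by (auto simp: linear_betw_def)
  have add: "g z (u + v) = g z u + g z v" if "z \<in> A" "u \<in> sp M z" "v \<in> sp M z" for z u v
    using assms(2)[OF that(1)[unfolded A_def]] that(2,3) by (simp add: linear_betw_def)
  have scale: "g z (s c v) = t c (g z v)" if "z \<in> A" "v \<in> sp M z" for z c v
    using assms(2)[OF that(1)[unfolded A_def]] that(2) by (simp add: linear_betw_def)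
  show ?thesis
    unfolding linear_betw_def restr_def dsum_map_def scale_pw_def fun_eq_iff A_def[symmetric]
    by (simp add: Pi_iff mem add scale)
qed

section \<open>Naturality of the nilpotent operators\<close>

lemma nth_subset_Union: "S ! Suc i \<subseteq> \<Union>(set S)" "S ! i \<subseteq> \<Union>(set S)" if "i < length S - 1"
  using that by (auto intro!: Union_upper nth_mem)

lemma jordan_op_outside: "jordan_op M S f y = 0" if "y \<notin> \<Union>(set S)"
proof -
  have "y \<notin> S ! Suc i" if "i < length S - 1" for i
    using nth_subset_Union(1)[OF that] \<open>y \<notin> \<Union>(set S)\<close> by blast
  then show ?thesis by (simp add: jordan_op_def)
qed

lemma jordan_term_mem:
  assumes "persistence_module P s M" "\<Union>(set S) \<subseteq> P" "f \<in> restr M S"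
    and "x \<in> \<Union>(set S)" "y \<in> \<Union>(set S)"
  shows "(if x < y then mp M y x (f x) else 0) \<in> sp M y"
proof -
  interpret vector_space s using assms(1) by (simp add: persistence_module_def)
  have P: "x \<in> P" "y \<in> P" "f x \<in> sp M x" using assms by (auto simp: restr_def)
  have "mp M y x \<in> sp M x \<rightarrow> sp M y" if "x < y"
    using assms(1) P that unfolding persistence_module_def linear_betw_def by auto
  moreover have "0 \<in> sp M y"
    using assms(1) P by (auto simp: persistence_module_def intro: subspace_0)
  ultimately show ?thesis using P(3) by auto
qed

lemma jordan_op_restr:
  assumes "persistence_module P s M" "\<Union>(set S) \<subseteq> P" "f \<in> restr M S"
  shows "jordan_op M S f \<in> restr M S"
proof -
  interpret vector_space s using assms(1) by (simp add: persistence_module_def)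
  have "jordan_op M S f y \<in> sp M y" if y: "y \<in> \<Union>(set S)" for y
  proof -
    have sub: "subspace (sp M y)"
      using y assms(2) by (intro persistence_module_subspace[OF assms(1)]) blast
    show ?thesis unfolding jordan_op_def
    proof (rule subspace_sum[OF sub])
      fix i assume i: "i \<in> {..<length S - 1}"
      have "(\<Sum>x\<in>S ! i. if x < y then mp M y x (f x) else 0) \<in> sp M y"
        using nth_subset_Union(2)[of i S] i y
        by (intro subspace_sum[OF sub] jordan_term_mem[OF assms]) auto
      then show "(if y \<in> S ! Suc i then \<Sum>x\<in>S ! i. if x < y then mp M y x (f x) else 0 else 0) \<in> sp M y"
        using subspace_0[OF sub] by simp
    qed
  qed
  then show ?thesis using jordan_op_outside by (intro restrI)
qed

lemma jordan_op_funpow_restr: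
  assumes "persistence_module P s M" "\<Union>(set S) \<subseteq> P" "f \<in> restr M S"
  shows "(jordan_op M S ^^ i) f \<in> restr M S"
  by (induction i) (use assms jordan_op_restr[OF assms(1,2)] in auto)

text \<open>Entry by entry this is the naturality square of \<open>g\<close> for
  \<open>x < y\<close>; linearity of \<open>g y\<close> carries it through the two nested
  sums.\<close>

lemma jordan_op_dsum_map:
  assumes "persistence_module P s M" "pm_hom P s t M N g"
    and "\<Union>(set S) \<subseteq> P" "f \<in> restr M S"
  shows "jordan_op N S (dsum_map (\<Union>(set S)) g f) = dsum_map (\<Union>(set S)) g (jordan_op M S f)"
proof
  fix y
  have vs: "vector_space s" using assms(1) by (simp add: persistence_module_def)
  interpret vector_space s by fact
  show "jordan_op N S (dsum_map (\<Union>(set S)) g f) y = dsum_map (\<Union>(set S)) g (jordan_op M S f) y"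
  proof (cases "y \<in> \<Union>(set S)")
    case False
    then show ?thesis by (simp add: dsum_map_def jordan_op_outside del: Union_iff)
  next
    case y: True
    have sub: "subspace (sp M y)" and lin: "linear_betw s t (sp M y) (sp N y) (g y)"
      using y assms(3)
      by (intro persistence_module_subspace[OF assms(1)] pm_hom_linear_betw[OF assms(2)]; blast)+
    note lin0 = linear_betw_zero[OF vs sub lin] and lin_sum = linear_betw_sum[OF vs sub lin]
    \<comment> \<open>\<open>m x\<close> is the contribution of the component at \<open>x\<close> to
      the operator's value at \<open>y\<close>, before the restriction to consecutive sets of
      \<open>S\<close>.\<close>
    define m where "m x = (if x < y then mp M y x (f x) else 0)" for x
    have m_mem: "m x \<in> sp M y" if "x \<in> \<Union>(set S)" for x
      unfolding m_def by (rule jordan_term_mem[OF assms(1,3,4) that y])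
    \<comment> \<open>For \<open>x < y\<close> this is naturality; otherwise both sides vanish
      because \<open>g y 0 = 0\<close>.\<close>
    have m_map: "g y (m x) = (if x < y then mp N y x (dsum_map (\<Union>(set S)) g f x) else 0)"
      if "x \<in> \<Union>(set S)" for x
    proof -
      have "x \<in> P" "y \<in> P" "f x \<in> sp M x" using assms(3,4) that y by (auto simp: restr_def)
      then show ?thesis
        using assms(2) that lin0 by (auto simp: m_def dsum_map_def pm_hom_def)
    qed
    have inner: "(\<Sum>x\<in>S ! i. m x) \<in> sp M y"
      "g y (\<Sum>x\<in>S ! i. m x)
        = (\<Sum>x\<in>S ! i. if x < y then mp N y x (dsum_map (\<Union>(set S)) g f x) else 0)"
      if "i < length S - 1" for i
    proof -
      have "S ! i \<subseteq> \<Union>(set S)" by (rule nth_subset_Union(2)[OF that])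
      then have mem: "m x \<in> sp M y"
        and map: "g y (m x) = (if x < y then mp N y x (dsum_map (\<Union>(set S)) g f x) else 0)"
        if "x \<in> S ! i" for x
        using m_mem m_map that by blast+
      show "(\<Sum>x\<in>S ! i. m x) \<in> sp M y" using mem by (intro subspace_sum[OF sub])
      show "g y (\<Sum>x\<in>S ! i. m x)
          = (\<Sum>x\<in>S ! i. if x < y then mp N y x (dsum_map (\<Union>(set S)) g f x) else 0)"
        using mem map by (subst lin_sum) (auto intro: sum.cong)
    qed
    have "dsum_map (\<Union>(set S)) g (jordan_op M S f) y
        = g y (\<Sum>i<length S - 1. if y \<in> S ! Suc i then \<Sum>x\<in>S ! i. m x else 0)"
      unfolding dsum_map_def jordan_op_def m_def[abs_def] using y by simp
    also have "\<dots> = (\<Sum>i<length S - 1. g y (if y \<in> S ! Suc i then \<Sum>x\<in>S ! i. m x else 0))"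
      using inner(1) subspace_0[OF sub] by (intro lin_sum) auto
    also have "\<dots> = jordan_op N S (dsum_map (\<Union>(set S)) g f) y"
      unfolding jordan_op_def using inner(2) lin0 by (intro sum.cong) auto
    finally show ?thesis ..
  qed
qed

lemma dsum_map_restr:
  assumes "pm_hom P s t M N g" "\<Union>(set S) \<subseteq> P" "f \<in> restr M S"
  shows "dsum_map (\<Union>(set S)) g f \<in> restr N S"
  using assms by (fastforce simp: restr_def dsum_map_def pm_hom_def linear_betw_def)

text \<open>The one-step identity applies at each stage because the iterates stay in the direct
  sum.\<close>

lemma jordan_op_funpow_dsum_map:
  assumes "persistence_module P s M" "pm_hom P s t M N g"
    and "\<Union>(set S) \<subseteq> P" "f \<in> restr M S"
  shows "(jordan_op N S ^^ i) (dsum_map (\<Union>(set S)) g f)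
    = dsum_map (\<Union>(set S)) g ((jordan_op M S ^^ i) f)"
  by (induction i)
    (simp_all add: jordan_op_dsum_map[OF assms(1-3)] jordan_op_funpow_restr[OF assms(1,3,4)])

section \<open>Shifted modules and induced maps of Jordan modules\<close>

lemma persistence_module_shift:
  fixes M :: "('p::ordered_ab_semigroup_add, 'v::ab_group_add) pmod"
  assumes "persistence_module P s M" "\<And>z. z \<in> P \<Longrightarrow> z + x \<in> P"
  shows "persistence_module P s (shift M x)"
  using assms unfolding persistence_module_def shift_def by (simp add: add_right_mono)

lemma pm_hom_shift:
  fixes M :: "('p::ordered_ab_semigroup_add, 'v::ab_group_add) pmod"
  assumes "pm_hom P s t M N g" "\<And>z. z \<in> P \<Longrightarrow> z + x \<in> P"
  shows "pm_hom P s t (shift M x) (shift N x) (shift_hom g x)"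
  using assms unfolding pm_hom_def shift_def shift_hom_def by (simp add: add_right_mono)

lemma shift_shift: "shift (shift M e) x = shift M (x + e)"
  for M :: "('p::ab_semigroup_add, 'v) pmod"
  by (simp add: shift_def add.assoc)

text \<open>Shifting \<open>g\<close> by \<open>x\<close> gives a homomorphism from
  \<open>shift M x\<close> to \<open>shift N (x + e)\<close>. Its direct sum commutes with the
  \<open>i\<close>-th powers of the operators, so a preimage \<open>f0\<close> of \<open>f\<close>
  maps to a preimage of the image of \<open>f\<close>.\<close>

lemma dsum_map_jordan_module:
  fixes M :: "('p::ordered_ab_semigroup_add, 'v::ab_group_add) pmod"
  assumes "persistence_module P s M" "pm_hom P s t M (shift N e) g"
    and "\<Union>(set S) \<subseteq> P" "\<And>z. z \<in> P \<Longrightarrow> z + x \<in> P"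
    and "f \<in> sp (jordan_module M S i) x"
  shows "dsum_map (\<Union>(set S)) (shift_hom g x) f \<in> sp (jordan_module N S i) (x + e)"
proof -
  obtain f0 where f0: "f0 \<in> restr (shift M x) S" "f = (jordan_op (shift M x) S ^^ i) f0"
    using assms(5) by (auto simp: sp_jordan_module)
  have hom: "pm_hom P s t (shift M x) (shift N (x + e)) (shift_hom g x)"
    using pm_hom_shift[OF assms(2,4)] by (simp add: shift_shift)
  have "dsum_map (\<Union>(set S)) (shift_hom g x) f
      = (jordan_op (shift N (x + e)) S ^^ i) (dsum_map (\<Union>(set S)) (shift_hom g x) f0)"
    unfolding f0(2)
    by (rule jordan_op_funpow_dsum_map[symmetric, OF persistence_module_shift hom])
      (use assms f0(1) in auto)
  then show ?thesis
    using dsum_map_restr[OF hom assms(3) f0(1)] by (simp add: sp_jordan_module)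
qed

lemma sp_jordan_module_restr:
  fixes M :: "('p::ordered_ab_semigroup_add, 'v::ab_group_add) pmod"
  assumes "persistence_module P s M" "\<Union>(set S) \<subseteq> P" "\<And>z. z \<in> P \<Longrightarrow> z + x \<in> P"
  shows "sp (jordan_module M S i) x \<subseteq> restr (shift M x) S"
  using jordan_op_funpow_restr[OF persistence_module_shift[OF assms(1,3)] assms(2)]
  by (auto simp: sp_jordan_module)

text \<open>Places the image of a structure map inside the direct sum, where the maps induced by
  homomorphisms are linear and the dimension bound applies.\<close>

lemma jordan_module_map_restr:
  fixes M :: "('p::ordered_ab_semigroup_add, 'v::ab_group_add) pmod"
  assumes "persistence_module P s M" "\<Union>(set S) \<subseteq> P"
    and "\<And>z. z \<in> P \<Longrightarrow> z + x \<in> P" "\<And>z. z \<in> P \<Longrightarrow> z + y \<in> P" "x \<le> y"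
  shows "mp (jordan_module M S i) y x ` sp (jordan_module M S i) x \<subseteq> restr (shift M y) S"
proof -
  have "linear_betw (scale_pw s) (scale_pw s) (restr (shift M x) S) (restr (shift M y) S)
      (mp (jordan_module M S i) y x)"
    unfolding mp_jordan_module
  proof (rule linear_betw_dsum_map)
    fix z assume "z \<in> \<Union>(set S)"
    then have "x + z \<in> P" "y + z \<in> P" "x + z \<le> y + z"
      using assms(2-5) by (auto simp: add.commute[of _ z] intro: add_left_mono)
    then show "linear_betw s s (sp (shift M x) z) (sp (shift M y) z) (mp M (y + z) (x + z))"
      using assms(1) by (simp add: persistence_module_def shift_def add.commute)
  qed (use assms(1) in \<open>simp add: persistence_module_def\<close>)
  then show ?thesis
    using sp_jordan_module_restr[OF assms(1-3), of i] unfolding linear_betw_def by blast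
qed

subsection \<open>Erosion and interleaving\<close>

text \<open>The structure map of the Jordan module of \<open>M\<close> from \<open>x - e\<close> to
  \<open>y + e\<close> is the composite of the map induced by \<open>\<phi>\<close> at
  \<open>x - e\<close>, the structure map for \<open>N\<close> from \<open>x\<close> to
  \<open>y\<close>, and the map induced by \<open>\<psi>\<close> at \<open>y\<close>. The symmetric
  bound comes from exchanging \<open>M\<close> and \<open>N\<close>.\<close>

lemma jordan_rank_erosion:
  fixes M :: "(real^'d, 'v::ab_group_add) pmod" and N :: "(real^'d, 'w::ab_group_add) pmod"
  assumes M: "persistence_module P s M" and N: "persistence_module P t N"
    and \<phi>: "pm_hom P s t M (shift N e) \<phi>" and \<psi>: "pm_hom P t s N (shift M e) \<psi>"
    and comp: "\<forall>x\<in>P. \<forall>v\<in>sp M x. shift_hom \<psi> e x (\<phi> x v) = sh M (e + e) x v"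
    and S: "\<Union>(set S) \<subseteq> P"
    and add: "\<And>a b. a \<in> P \<Longrightarrow> b \<in> P \<Longrightarrow> a + b \<in> P"
    and diff: "\<And>a b. a \<in> P \<Longrightarrow> b \<in> P \<Longrightarrow> a - b \<in> P"
    and e: "e \<in> P" "0 \<le> e" and xy: "x \<in> P" "y \<in> P"
  shows "jordan_rank s M S i (x - e) (y + e) \<le> jordan_rank t N S i x y"
proof (cases "x \<le> y \<and> finite_dim (scale_pw t) (mp (jordan_module N S i) y x ` sp (jordan_module N S i) x)")
  case False
  \<comment> \<open>The right-hand side takes its default value \<open>\<infinity>\<close>, given to
    incomparable indices and to images of infinite dimension.\<close>
  then have "jordan_rank t N S i x y = \<infinity>"
    unfolding jordan_rank_def rank_inv_def by (simp only: if_False)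
  then show ?thesis by simp
next
  case True
  then have le: "x \<le> y" by simp
  have e_le: "a - e \<le> a" "a \<le> a + e" for a
    using e(2) by (simp_all add: diff_le_eq)
  let ?A = "\<Union>(set S)"
  \<comment> \<open>The ranks to compare are the dimensions of \<open>?W\<close> and
    \<open>?U\<close>; \<open>?f\<close> is the map induced by \<open>\<psi>\<close> at
    \<open>y\<close>.\<close>
  let ?U = "mp (jordan_module N S i) y x ` sp (jordan_module N S i) x"
  let ?f = "dsum_map ?A (shift_hom \<psi> y)"
  let ?W = "mp (jordan_module M S i) (y + e) (x - e) ` sp (jordan_module M S i) (x - e)"
  have vs: "vector_space (scale_pw s)" "vector_space (scale_pw t)"
    using M N by (simp_all add: persistence_module_def vector_space_scale_pw)
  have \<psi>y: "pm_hom P t s (shift N y) (shift M (y + e)) (shift_hom \<psi> y)"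
    using pm_hom_shift[OF \<psi>, of y] add xy by (simp add: shift_shift)
  have lin: "linear_betw (scale_pw t) (scale_pw s) (restr (shift N y) S) (restr (shift M (y + e)) S) ?f"
    by (rule linear_betw_dsum_map)
      (use M \<psi>y S in \<open>auto simp: persistence_module_def pm_hom_def\<close>)
  have sub: "module.subspace (scale_pw t) (restr (shift N y) S)"
    by (rule subspace_restr[OF persistence_module_shift[OF N] S]) (use add xy in auto)
  have U: "?U \<subseteq> restr (shift N y) S"
    by (rule jordan_module_map_restr[OF N S]) (use add xy le in auto)
  have W: "?W \<subseteq> ?f ` ?U"
  proof
    fix h assume "h \<in> ?W"
    then obtain f where f: "f \<in> sp (jordan_module M S i) (x - e)"
      "h = mp (jordan_module M S i) (y + e) (x - e) f" by blast
    have f_restr: "f \<in> restr (shift M (x - e)) S"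
      using sp_jordan_module_restr[OF M S, of "x - e" i] f(1) add diff xy e by blast
    \<comment> \<open>The map induced by \<open>\<phi>\<close> at \<open>x - e\<close> carries
      \<open>f\<close> to the Jordan module of \<open>N\<close> at
      \<open>x - e + e = x\<close>.\<close>
    let ?g = "dsum_map ?A (shift_hom \<phi> (x - e)) f"
    have "?g \<in> sp (jordan_module N S i) (x - e + e)"
      by (rule dsum_map_jordan_module[OF M \<phi> S _ f(1)]) (use add diff xy e in auto)
    then have g: "?g \<in> sp (jordan_module N S i) x" by simp
    have "h = ?f (mp (jordan_module N S i) y x ?g)"
    proof
      fix z
      show "h z = ?f (mp (jordan_module N S i) y x ?g) z"
      proof (cases "z \<in> ?A")
        case False
        then show ?thesis by (simp add: f(2) mp_jordan_module dsum_map_def)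
      next
        case z: True
        \<comment> \<open>\<open>?a\<close> is the source index of the component at
          \<open>z\<close>. Naturality of \<open>\<phi>\<close> moves the structure map of
          \<open>N\<close> to one of \<open>M\<close> from \<open>?a\<close> to \<open>?b\<close>;
          at \<open>?b\<close> the composite of \<open>\<phi>\<close> and \<open>\<psi>\<close> is
          the shift by \<open>e + e\<close>, which ends at \<open>y + e + z\<close>. Functoriality
          of \<open>M\<close> joins the two pieces.\<close>
        let ?a = "x - e + z" and ?b = "y - e + z"
        have v: "f z \<in> sp M ?a"
          using restr_mem[OF f_restr z] by (simp add: shift_def add.commute)
        have "z \<in> P" using z S by blast
        then have P: "?a \<in> P" "?b \<in> P" "y + e + z \<in> P" "x + z \<in> P" "y + z \<in> P"
          by (intro add diff xy e(1); assumption)+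
        have ab: "?a \<le> ?b" using le by simp
        have b: "?b \<le> y + e + z"
          using order_trans[OF e_le] by (intro add_right_mono) simp
        have eqs: "?a + e = x + z" "?b + e = y + z" "?b + (e + e) = y + e + z"
          by (simp_all add: algebra_simps)
        have v': "mp M ?b ?a (f z) \<in> sp M ?b"
          using persistence_module_linear_betw[OF M P(1,2) ab] v by (auto simp: linear_betw_def)
        have "mp N (y + z) (x + z) (\<phi> ?a (f z)) = \<phi> ?b (mp M ?b ?a (f z))"
          using \<phi> P(1,2) ab v eqs unfolding pm_hom_def shift_def by auto
        moreover have "\<psi> (y + z) (\<phi> ?b (mp M ?b ?a (f z))) = mp M (y + e + z) ?b (mp M ?b ?a (f z))"
          using comp[rule_format, OF P(2) v', unfolded shift_hom_def sh_def eqs] .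
        moreover have "\<dots> = mp M (y + e + z) ?a (f z)"
          using M P(1-3) ab b v by (simp add: persistence_module_def)
        ultimately show ?thesis
          using z by (simp add: f(2) mp_jordan_module dsum_map_def shift_hom_def add.commute)
      qed
    qed
    then show "h \<in> ?f ` ?U" using g by blast
  qed
  have fin: "finite_dim (scale_pw s) (?f ` ?U)"
    and dim: "vector_space.dim (scale_pw s) (?f ` ?U) \<le> vector_space.dim (scale_pw t) ?U"
    using dim_linear_betw_image_le[OF vs(2,1) sub lin U] True by auto
  \<comment> \<open>With finite dimension of \<open>?W\<close>, comparability makes the left-hand
    rank a genuine dimension instead of the default \<open>\<infinity>\<close>.\<close>
  have "x - e \<le> y + e"
    by (rule order_trans[OF e_le(1) order_trans[OF le e_le(2)]])
  then show ?thesis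
    using True finite_dim_mono[OF W fin] dim dim_mono_finite_dim[OF vs(1) W fin]
    by (simp add: jordan_rank_def rank_inv_def)
qed

subsection \<open>Landscapes\<close>

lemma infnorm_vec: "infnorm (vec a :: real^'d) = \<bar>a\<bar>"
  by (simp add: infnorm_cart)

text \<open>If \<open>h\<close> has norm at most \<open>\<delta> - \<epsilon>\<close>, then
  \<open>h + vec \<epsilon>\<close> has norm at most \<open>\<delta>\<close>, and erosion at
  \<open>x - h\<close> and \<open>x + h\<close> turns the rank bound for \<open>X\<close> into one
  for \<open>Y\<close>. The erosion hypothesis also covers incomparable pairs, so the signs of the
  coordinates of \<open>h\<close> need no case distinction.\<close>

lemma landscape_le_erosion:
  fixes X :: "(real^'d, 'v::ab_group_add) pmod" and Y :: "(real^'d, 'w::ab_group_add) pmod"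
  assumes erosion: "\<And>a b. a \<in> grid T \<Longrightarrow> b \<in> grid T \<Longrightarrow>
      rank_inv s X (a - vec \<epsilon>) (b + vec \<epsilon>) \<le> rank_inv t Y a b"
    and add: "\<And>a b. a \<in> T \<Longrightarrow> b \<in> T \<Longrightarrow> a + b \<in> T"
    and diff: "\<And>a b. a \<in> T \<Longrightarrow> b \<in> T \<Longrightarrow> a - b \<in> T"
    and \<epsilon>: "\<epsilon> \<in> T" "0 \<le> \<epsilon>" and x: "x \<in> grid T"
  shows "landscape T s X k x \<le> landscape T t Y k x + ennreal \<epsilon>"
  unfolding landscape_def[of T s X]
proof (rule Sup_least, clarify)
  fix \<delta> assume \<delta>: "\<delta> \<in> T" "0 < \<delta>"
    and rank: "\<forall>h\<in>grid T. infnorm h \<le> \<delta> \<longrightarrow> enat k \<le> rank_inv s X (x - h) (x + h)"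
  show "ennreal \<delta> \<le> landscape T t Y k x + ennreal \<epsilon>"
  proof (cases "\<delta> \<le> \<epsilon>")
    \<comment> \<open>Here \<open>\<delta> - \<epsilon>\<close> is not a positive radius, but the
      summand \<open>\<epsilon>\<close> alone dominates \<open>\<delta>\<close>.\<close>
    case True
    then show ?thesis by (simp add: add_increasing ennreal_leI)
  next
    case False
    have "enat k \<le> rank_inv t Y (x - h) (x + h)" if h: "h \<in> grid T" "infnorm h \<le> \<delta> - \<epsilon>" for h
    proof -
      have "infnorm (h + vec \<epsilon>) \<le> infnorm h + infnorm (vec \<epsilon> :: real^'d)" by (rule infnorm_triangle)
      then have "infnorm (h + vec \<epsilon>) \<le> \<delta>" using h(2) \<epsilon>(2) by (simp add: infnorm_vec)
      moreover have "h + vec \<epsilon> \<in> grid T" using h(1) \<epsilon>(1) add by (simp add: grid_def)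
      ultimately have "enat k \<le> rank_inv s X (x - (h + vec \<epsilon>)) (x + (h + vec \<epsilon>))"
        using rank by blast
      also have "\<dots> = rank_inv s X (x - h - vec \<epsilon>) (x + h + vec \<epsilon>)" by (simp add: algebra_simps)
      also have "\<dots> \<le> rank_inv t Y (x - h) (x + h)"
        using x h(1) add diff by (intro erosion) (simp_all add: grid_def)
      finally show ?thesis .
    qed
    then have "ennreal (\<delta> - \<epsilon>) \<le> landscape T t Y k x"
      unfolding landscape_def using \<delta>(1) \<epsilon>(1) diff False by (intro Sup_upper imageI) auto
    then have "ennreal (\<delta> - \<epsilon>) + ennreal \<epsilon> \<le> landscape T t Y k x + ennreal \<epsilon>"
      by (rule add_right_mono)
    then show ?thesis using False \<epsilon>(2) by (simp flip: ennreal_plus)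
  qed
qed

text \<open>As \<open>ennreal c\<close> is finite, the hypotheses force \<open>a\<close> and
  \<open>b\<close> to be both infinite, where the convention gives 0, or both finite, where the
  truncated differences are bounded separately.\<close>

lemma abs_diff_le: "abs_diff a b \<le> ennreal c" if "a \<le> b + ennreal c" "b \<le> a + ennreal c"
  using that by (cases "a = \<infinity>"; cases "b = \<infinity>")
    (auto simp: abs_diff_def ennreal_minus_le_iff add.commute top_unique)

text \<open>Every \<open>\<epsilon>\<close> admissible for the erosion distance bounds the landscape
  difference at each point; the two halves of the erosion condition give the two directions.\<close>

lemma sup_dist_landscape_le_erosion_dist:
  fixes X :: "(real^'d, 'v::ab_group_add) pmod" and Y :: "(real^'d, 'w::ab_group_add) pmod"
  assumes "\<And>a b. a \<in> T \<Longrightarrow> b \<in> T \<Longrightarrow> a + b \<in> T" "\<And>a b. a \<in> T \<Longrightarrow> b \<in> T \<Longrightarrow> a - b \<in> T"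
  shows "sup_dist T (landscape T s X) (landscape T t Y)
    \<le> erosion_dist T (rank_inv s X) (rank_inv t Y)"
  unfolding erosion_dist_def sup_dist_def
  by (rule Inf_greatest, rule SUP_least)
    (auto intro!: abs_diff_le landscape_le_erosion[OF _ assms])

text \<open>Every interleaving parameter satisfies the erosion condition, so the erosion distance is
  an infimum over a larger set.\<close>

lemma erosion_dist_le_interleaving_dist:
  fixes M :: "(real^'d, 'v::ab_group_add) pmod" and N :: "(real^'d, 'w::ab_group_add) pmod"
  assumes add: "\<And>a b. a \<in> T \<Longrightarrow> b \<in> T \<Longrightarrow> a + b \<in> T"
    and diff: "\<And>a b. a \<in> T \<Longrightarrow> b \<in> T \<Longrightarrow> a - b \<in> T"
    and M: "persistence_module (grid T) s M" and N: "persistence_module (grid T) t N"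
    and S: "\<Union>(set S) \<subseteq> grid T"
  shows "erosion_dist T (jordan_rank s M S i) (jordan_rank t N S i) \<le> interleaving_dist T s t M N"
  unfolding erosion_dist_def interleaving_dist_def
proof (rule Inf_superset_mono, rule image_mono, rule Collect_mono, intro impI, elim conjE, intro conjI)
  fix \<epsilon> assume \<epsilon>: "\<epsilon> \<in> T" "0 \<le> \<epsilon>" and "interleaved T s t M N \<epsilon>"
  then obtain \<phi> \<psi> where
    \<phi>: "pm_hom (grid T) s t M (shift N (vec \<epsilon>)) \<phi>" and
    \<psi>: "pm_hom (grid T) t s N (shift M (vec \<epsilon>)) \<psi>" and
    \<psi>\<phi>: "\<forall>x\<in>grid T. \<forall>v\<in>sp M x. shift_hom \<psi> (vec \<epsilon>) x (\<phi> x v) = sh M (vec (2 * \<epsilon>)) x v" and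
    \<phi>\<psi>: "\<forall>x\<in>grid T. \<forall>w\<in>sp N x. shift_hom \<phi> (vec \<epsilon>) x (\<psi> x w) = sh N (vec (2 * \<epsilon>)) x w"
    unfolding interleaved_def by blast
  have double: "vec (2 * \<epsilon>) = (vec \<epsilon> + vec \<epsilon> :: real^'d)" by (simp add: vec_eq_iff)
  have grid: "vec \<epsilon> \<in> grid T" "(0 :: real^'d) \<le> vec \<epsilon>"
    "a + b \<in> grid T" "a - b \<in> grid T" if "a \<in> grid T" "b \<in> grid T" for a b :: "real^'d"
    using that add diff \<epsilon> by (simp_all add: grid_def less_eq_vec_def)
  show "\<forall>x\<in>grid T. \<forall>y\<in>grid T.
      jordan_rank s M S i (x - vec \<epsilon>) (y + vec \<epsilon>) \<le> jordan_rank t N S i x y \<and>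
      jordan_rank t N S i (x - vec \<epsilon>) (y + vec \<epsilon>) \<le> jordan_rank s M S i x y"
    using jordan_rank_erosion[OF M N \<phi> \<psi> \<psi>\<phi>[unfolded double] S]
      jordan_rank_erosion[OF N M \<psi> \<phi> \<phi>\<psi>[unfolded double] S] grid
    by blast
qed

theorem theorem2:
  fixes T :: "real set"
    and S :: "(real^'d) set list"
    and s :: "'k::field \<Rightarrow> 'v::ab_group_add \<Rightarrow> 'v"
    and t :: "'k \<Rightarrow> 'w::ab_group_add \<Rightarrow> 'w"
    and M :: "(real^'d, 'v) pmod"
    and N :: "(real^'d, 'w) pmod"
  assumes "T = \<int> \<or> T = UNIV"
    and "length S \<ge> 2"
    and "\<forall>A\<in>set S. finite A \<and> A \<subseteq> grid T"
    and "disjoint_family_on (\<lambda>i. S ! i) {..<length S}"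
    and "persistence_module (grid T) s M" and "pointwise_finite_dim (grid T) s M"
    and "persistence_module (grid T) t N" and "pointwise_finite_dim (grid T) t N"
  shows "landscape_dist_at T s t S M N \<le> erosion_dist_at T s t S M N \<and>
         erosion_dist_at T s t S M N \<le> interleaving_dist T s t M N"
proof
  \<comment> \<open>The two choices of \<open>T\<close> are treated uniformly through closure under
    addition and subtraction.\<close>
  have add: "\<And>a b. a \<in> T \<Longrightarrow> b \<in> T \<Longrightarrow> a + b \<in> T"
    and diff: "\<And>a b. a \<in> T \<Longrightarrow> b \<in> T \<Longrightarrow> a - b \<in> T"
    using assms(1) by auto
  have S: "\<Union>(set S) \<subseteq> grid T" using assms(3) by blast
  have *: "sup_dist T (landscape T (scale_pw s) (jordan_module M S i))
      (landscape T (scale_pw t) (jordan_module N S i))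
    \<le> erosion_dist T (jordan_rank s M S i) (jordan_rank t N S i)" for i
    using sup_dist_landscape_le_erosion_dist[OF add diff] by (simp add: jordan_rank_def[abs_def])
  show "landscape_dist_at T s t S M N \<le> erosion_dist_at T s t S M N"
    unfolding landscape_dist_at_def erosion_dist_at_def
    by (intro Max.boundedI) (auto intro!: order_trans[OF *] Max_ge)
  \<comment> \<open>The interleaving distance does not depend on \<open>i\<close>, so it bounds the
    maximum once it bounds each entry.\<close>
  show "erosion_dist_at T s t S M N \<le> interleaving_dist T s t M N"
    unfolding erosion_dist_at_def
    by (rule Max.boundedI)
      (auto intro: erosion_dist_le_interleaving_dist[OF add diff assms(5,7) S])
qed

end
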